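(* Let $\alpha^{(0)},\alpha^{(1)},\beta^{(0)},\beta^{(1)}\in\mathbb{C}$, and let $\varphi_{dual}$ be the dual QRT map, i.e. the 4-dimensional rational map $$(w_1,w_2,v_1,v_2)\longmapsto(w_2,w_3,v_2,v_3),$$ $$w_3=w_1^{-1}w_2^{-1}\big(\alpha^{(0)}w_2+\beta^{(0)}\big),\qquad v_3=-w_2^{-1}w_3v_2-w_1^{-1}w_3v_1+w_1^{-1}w_2^{-1}\big(\alpha^{(0)}v_2+\alpha^{(1)}w_2+\beta^{(1)}\big).$$ Then $\varphi_{dual}$ is bi-Hamiltonian, in the sense that it preserves the pencil of Poisson brackets $\{\,,\,\}$ with parameter $\zeta\in\mathbb{C}$ defined by $$\{w_1,w_2\}=\{w_1,v_1\}=\{w_2,v_2\}=0,\qquad \{w_2,v_1\}=-\{w_1,v_2\}=w_1w_2,$$ $$\{v_1,v_2\}=w_1w_2\,\zeta-w_1v_2-w_2v_1.$$ Furthermore, the even and odd components of the first integral $J=J^{(0)}+\varepsilon J^{(1)}$, $$J^{(0)}=w_1+w_2+\alpha^{(0)}\left(\frac1{w_1}+\frac1{w_2}\right)+\frac{\beta^{(0)}}{w_1w_2},$$ $$J^{(1)}=\left(1-\frac{\alpha^{(0)}}{w_1^2}-\frac{\beta^{(0)}}{w_1^2w_2}\right)v_1+\left(1-\frac{\alpha^{(0)}}{w_2^2}-\frac{\beta^{(0)}}{w_1w_2^2}\right)v_2+\alpha^{(1)}\left(\frac1{w_1}+\frac1{w_2}\right)+\frac{\beta^{(1)}}{w_1w_2},$$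 are in involution with respect to this pencil (i.e. $\{J^{(0)},J^{(1)}\}=0$ for all $\zeta\in\mathbb{C}$), hence $\varphi_{dual}$ is a Liouville integrable map in dimension 4.
   Context: Let $\mathbb{D}=\{x+y\varepsilon: x,y\in\mathbb{C},\ \varepsilon^2=0\}$ be the dual numbers. With $W_n=w_n+\varepsilon v_n$, $\alpha=\alpha^{(0)}+\alpha^{(1)}\varepsilon$, $\beta=\beta^{(0)}+\beta^{(1)}\varepsilon$, the map $\varphi_{dual}$ is the component form of $(W_1,W_2)\mapsto\big(W_2,\,W_1^{-1}(\alpha+\beta W_2^{-1})\big)$ with $W_1,W_2$ units of $\mathbb{D}$ (i.e. $w_1,w_2\neq0$), and the first integral is $J=W_1+W_2+\alpha(W_1^{-1}+W_2^{-1})+\beta W_1^{-1}W_2^{-1}$, which is invariant under $\varphi_{dual}$; $J^{(0)},J^{(1)}$ are its even ($\varepsilon^0$) and odd ($\varepsilon^1$) components. The phase space has coordinates $(w_1,w_2,v_1,v_2)$ with $w_1w_2\neq0$. "Preserves the pencil" means that, for every $\zeta\in\mathbb{C}$, the bracket is a Poisson bracket and $\{F\circ\varphi_{dual},G\circ\varphi_{dual}\}=\{F,G\}\circ\varphi_{dual}$ for all functions $F,G$ on the phase space. A map in dimension 4 is Liouville integrable if it preserves a nondegenerate Poisson bracket and has two functionally independent invariants that are in involution with respect to that bracket. *)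

theory Defs
  imports "HOL-Analysis.Analysis"
begin

subsection \<open>Dual numbers over the complex numbers\<close>

datatype dual_number = Dual (even_part: complex) (odd_part: complex)

instantiation dual_number :: comm_ring_1
begin

definition "0 = Dual 0 0"
definition "1 = Dual 1 0"
definition "X + Y = Dual (even_part X + even_part Y) (odd_part X + odd_part Y)"
definition "X - Y = Dual (even_part X - even_part Y) (odd_part X - odd_part Y)"
definition "- X = Dual (- even_part X) (- odd_part X)"
definition "X * Y = Dual (even_part X * even_part Y)
                         (even_part X * odd_part Y + odd_part X * even_part Y)"

instance
  by standard
    (auto simp: zero_dual_number_def one_dual_number_def plus_dual_number_def
      minus_dual_number_def uminus_dual_number_def times_dual_number_def algebra_simps
      intro: dual_number.expand)

end

instantiation dual_number :: inverse
begin

text \<open>\<^term>\<open>inverse X\<close> is the ring inverse when \<^term>\<open>X\<close> is a unit, that is, when its even part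
  is nonzero; it is 0 otherwise.\<close>

definition "inverse X =
  Dual (inverse (even_part X)) (- odd_part X / (even_part X)\<^sup>2)"
definition "X div Y = X * inverse (Y :: dual_number)"

instance ..

end

lemma dual_number_right_inverse:
  assumes "even_part X \<noteq> 0"
  shows "X * inverse X = 1"
  using assms
  by (simp add: inverse_dual_number_def times_dual_number_def one_dual_number_def
      field_simps power2_eq_square)

definition qrt_dual ::
  "dual_number \<Rightarrow> dual_number \<Rightarrow> dual_number \<times> dual_number \<Rightarrow> dual_number \<times> dual_number" where
  "qrt_dual \<alpha> \<beta> = (\<lambda>(W1, W2). (W2, inverse W1 * (\<alpha> + \<beta> * inverse W2)))"

definition qrt_dual_integral ::
  "dual_number \<Rightarrow> dual_number \<Rightarrow> dual_number \<Rightarrow> dual_number \<Rightarrow> dual_number" where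
  "qrt_dual_integral \<alpha> \<beta> W1 W2 =
     W1 + W2 + \<alpha> * (inverse W1 + inverse W2) + \<beta> * inverse W1 * inverse W2"

subsection \<open>Holomorphic functions and Poisson brackets in dimension 4\<close>

definition holomorphic_fun_on :: "(complex^4 \<Rightarrow> complex) \<Rightarrow> (complex^4) set \<Rightarrow> bool" where
  "holomorphic_fun_on F U \<longleftrightarrow>
     (\<forall>z\<in>U. \<exists>D. (F has_derivative D) (at z) \<and> (\<forall>c h. D (c *s h) = c * D h))"

definition partial :: "4 \<Rightarrow> (complex^4 \<Rightarrow> complex) \<Rightarrow> complex^4 \<Rightarrow> complex" where
  "partial i F z = deriv (\<lambda>t. F (z + t *s axis i 1)) 0"

text \<open>Functions are total, so ``the bracket of two functions on an open set \<open>U\<close>'' is an operation on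
  total functions whose values on \<open>U\<close> depend only on the arguments restricted to \<open>U\<close>: this is the
  third clause. All clauses are required for functions on every open part \<open>U\<close> of
  the phase space \<open>M\<close>, with \<open>U = M\<close> included.\<close>

definition poisson_bracket_on ::
  "(complex^4) set \<Rightarrow>
   ((complex^4 \<Rightarrow> complex) \<Rightarrow> (complex^4 \<Rightarrow> complex) \<Rightarrow> complex^4 \<Rightarrow> complex) \<Rightarrow> bool" where
  "poisson_bracket_on M B \<longleftrightarrow> open M \<and>
     (\<forall>U F G H. open U \<and> U \<subseteq> M \<and> holomorphic_fun_on F U \<and> holomorphic_fun_on G U \<and>
        holomorphic_fun_on H U \<longrightarrow>
          holomorphic_fun_on (B F G) U \<and>
          ((\<forall>z\<in>U. F z = G z) \<longrightarrow> (\<forall>z\<in>U. B F H z = B G H z)) \<and>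
          (\<forall>z\<in>U. B F G z = - B G F z) \<and>
          (\<forall>c. \<forall>z\<in>U. B (\<lambda>x. c * F x + G x) H z = c * B F H z + B G H z) \<and>
          (\<forall>z\<in>U. B (\<lambda>x. F x * G x) H z = F z * B G H z + G z * B F H z) \<and>
          (\<forall>z\<in>U. B F (B G H) z + B G (B H F) z + B H (B F G) z = 0))"

definition nondegenerate_bracket_on ::
  "(complex^4) set \<Rightarrow>
   ((complex^4 \<Rightarrow> complex) \<Rightarrow> (complex^4 \<Rightarrow> complex) \<Rightarrow> complex^4 \<Rightarrow> complex) \<Rightarrow> bool" where
  "nondegenerate_bracket_on M B \<longleftrightarrow>
     (\<forall>z\<in>M. invertible (\<chi> i j. B (\<lambda>x. x $ i) (\<lambda>x. x $ j) z))"

text \<open>The maps considered are rational: as a partial map of the phase space \<open>M\<close> to itself,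
  \<open>\<phi>\<close> is defined at those \<open>z \<in> M\<close> for which \<open>\<phi> z \<in> M\<close>.\<close>

definition preserves_bracket_on ::
  "(complex^4) set \<Rightarrow> (complex^4 \<Rightarrow> complex^4) \<Rightarrow>
   ((complex^4 \<Rightarrow> complex) \<Rightarrow> (complex^4 \<Rightarrow> complex) \<Rightarrow> complex^4 \<Rightarrow> complex) \<Rightarrow> bool" where
  "preserves_bracket_on M \<phi> B \<longleftrightarrow>
     (\<forall>U F G. open U \<and> U \<subseteq> M \<and> holomorphic_fun_on F U \<and> holomorphic_fun_on G U \<longrightarrow>
        (\<forall>z\<in>M. \<phi> z \<in> U \<longrightarrow> B (F \<circ> \<phi>) (G \<circ> \<phi>) z = B F G (\<phi> z)))"

definition preserves_poisson_pencil_on ::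
  "(complex^4) set \<Rightarrow> (complex^4 \<Rightarrow> complex^4) \<Rightarrow>
   (complex \<Rightarrow> (complex^4 \<Rightarrow> complex) \<Rightarrow> (complex^4 \<Rightarrow> complex) \<Rightarrow> complex^4 \<Rightarrow> complex) \<Rightarrow> bool"
  where
  "preserves_poisson_pencil_on M \<phi> B \<longleftrightarrow>
     (\<forall>\<zeta>. poisson_bracket_on M (B \<zeta>) \<and> preserves_bracket_on M \<phi> (B \<zeta>))"

definition invariant_on ::
  "(complex^4) set \<Rightarrow> (complex^4 \<Rightarrow> complex^4) \<Rightarrow> (complex^4 \<Rightarrow> complex) \<Rightarrow> bool" where
  "invariant_on M \<phi> F \<longleftrightarrow> (\<forall>z\<in>M. \<phi> z \<in> M \<longrightarrow> F (\<phi> z) = F z)"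

text \<open>As usual for rational integrals, functional independence means linear independence of the
  differentials at generic points, here on a dense subset of \<open>M\<close>.\<close>

definition functionally_independent_on ::
  "(complex^4) set \<Rightarrow> (complex^4 \<Rightarrow> complex) \<Rightarrow> (complex^4 \<Rightarrow> complex) \<Rightarrow> bool" where
  "functionally_independent_on M F G \<longleftrightarrow>
     M \<subseteq> closure {z \<in> M. \<forall>a b. (\<forall>i. a * partial i F z + b * partial i G z = 0) \<longrightarrow>
                              a = 0 \<and> b = 0}"

definition in_involution_on ::
  "(complex^4) set \<Rightarrow>
   ((complex^4 \<Rightarrow> complex) \<Rightarrow> (complex^4 \<Rightarrow> complex) \<Rightarrow> complex^4 \<Rightarrow> complex) \<Rightarrow>
   (complex^4 \<Rightarrow> complex) \<Rightarrow> (complex^4 \<Rightarrow> complex) \<Rightarrow> bool" where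
  "in_involution_on M B F G \<longleftrightarrow> (\<forall>z\<in>M. B F G z = 0)"

definition liouville_integrable_with ::
  "(complex^4) set \<Rightarrow> (complex^4 \<Rightarrow> complex^4) \<Rightarrow>
   ((complex^4 \<Rightarrow> complex) \<Rightarrow> (complex^4 \<Rightarrow> complex) \<Rightarrow> complex^4 \<Rightarrow> complex) \<Rightarrow>
   (complex^4 \<Rightarrow> complex) \<Rightarrow> (complex^4 \<Rightarrow> complex) \<Rightarrow> bool" where
  "liouville_integrable_with M \<phi> B F G \<longleftrightarrow>
     poisson_bracket_on M B \<and> nondegenerate_bracket_on M B \<and> preserves_bracket_on M \<phi> B \<and>
     holomorphic_fun_on F M \<and> holomorphic_fun_on G M \<and>
     invariant_on M \<phi> F \<and> invariant_on M \<phi> G \<and>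
     functionally_independent_on M F G \<and> in_involution_on M B F G"

definition liouville_integrable ::
  "(complex^4) set \<Rightarrow> (complex^4 \<Rightarrow> complex^4) \<Rightarrow> bool" where
  "liouville_integrable M \<phi> \<longleftrightarrow> (\<exists>B F G. liouville_integrable_with M \<phi> B F G)"

subsection \<open>The dual QRT map in components\<close>

text \<open>A point is \<open>z = (w\<^sub>1, w\<^sub>2, v\<^sub>1, v\<^sub>2)\<close>, with components \<open>z $ 1, \<dots>, z $ 4\<close> in this order.\<close>

definition phase_space :: "(complex^4) set" where
  "phase_space = {z. z $ 1 * z $ 2 \<noteq> 0}"

definition phi_dual ::
  "complex \<Rightarrow> complex \<Rightarrow> complex \<Rightarrow> complex \<Rightarrow> complex^4 \<Rightarrow> complex^4" where
  "phi_dual \<alpha>0 \<alpha>1 \<beta>0 \<beta>1 z =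
     (let w1 = z $ 1; w2 = z $ 2; v1 = z $ 3; v2 = z $ 4;
          w3 = inverse w1 * inverse w2 * (\<alpha>0 * w2 + \<beta>0);
          v3 = - inverse w2 * w3 * v2 - inverse w1 * w3 * v1
               + inverse w1 * inverse w2 * (\<alpha>0 * v2 + \<alpha>1 * w2 + \<beta>1)
      in vector [w2, w3, v2, v3])"

definition J0 :: "complex \<Rightarrow> complex \<Rightarrow> complex^4 \<Rightarrow> complex" where
  "J0 \<alpha>0 \<beta>0 z =
     (let w1 = z $ 1; w2 = z $ 2
      in w1 + w2 + \<alpha>0 * (1 / w1 + 1 / w2) + \<beta>0 / (w1 * w2))"

definition J1 ::
  "complex \<Rightarrow> complex \<Rightarrow> complex \<Rightarrow> complex \<Rightarrow> complex^4 \<Rightarrow> complex" where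
  "J1 \<alpha>0 \<alpha>1 \<beta>0 \<beta>1 z =
     (let w1 = z $ 1; w2 = z $ 2; v1 = z $ 3; v2 = z $ 4
      in (1 - \<alpha>0 / w1\<^sup>2 - \<beta>0 / (w1\<^sup>2 * w2)) * v1
         + (1 - \<alpha>0 / w2\<^sup>2 - \<beta>0 / (w1 * w2\<^sup>2)) * v2
         + \<alpha>1 * (1 / w1 + 1 / w2) + \<beta>1 / (w1 * w2))"

text \<open>The \<open>(i, j)\<close> entry is the bracket of the \<open>i\<close>-th and the \<open>j\<close>-th coordinate function; a bracket of
  coordinates extends to all functions by the derivation property.\<close>

definition pencil_matrix :: "complex \<Rightarrow> complex^4 \<Rightarrow> complex^4^4" where
  "pencil_matrix \<zeta> z =
     (let w1 = z $ 1; w2 = z $ 2; v1 = z $ 3; v2 = z $ 4;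
          \<kappa> = w1 * w2 * \<zeta> - w1 * v2 - w2 * v1
      in vector
          [vector [0,         0,           0,         - (w1 * w2)],
           vector [0,         0,           w1 * w2,   0],
           vector [0,         - (w1 * w2), 0,         \<kappa>],
           vector [w1 * w2,   0,           - \<kappa>,       0]])"

definition pencil_bracket ::
  "complex \<Rightarrow> (complex^4 \<Rightarrow> complex) \<Rightarrow> (complex^4 \<Rightarrow> complex) \<Rightarrow> complex^4 \<Rightarrow> complex" where
  "pencil_bracket \<zeta> F G z =
     (\<Sum>i\<in>UNIV. \<Sum>j\<in>UNIV. pencil_matrix \<zeta> z $ i $ j * partial i F z * partial j G z)"

text \<open>\<open>W\<^sub>1 = w\<^sub>1 + v\<^sub>1 \<epsilon>\<close> and \<open>W\<^sub>2 = w\<^sub>2 + v\<^sub>2 \<epsilon>\<close>.\<close>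

definition dual_coords :: "complex^4 \<Rightarrow> dual_number \<times> dual_number" where
  "dual_coords z = (Dual (z $ 1) (z $ 3), Dual (z $ 2) (z $ 4))"

lemma vector_4_nth:
  "(vector [a, b, c, d] :: 'a::zero^4) $ 1 = a"
  "(vector [a, b, c, d] :: 'a::zero^4) $ 2 = b"
  "(vector [a, b, c, d] :: 'a::zero^4) $ 3 = c"
  "(vector [a, b, c, d] :: 'a::zero^4) $ 4 = d"
  unfolding vector_def by simp_all

lemma phi_dual_components:
  assumes "z \<in> phase_space"
  shows "dual_coords (phi_dual \<alpha>0 \<alpha>1 \<beta>0 \<beta>1 z) =
         qrt_dual (Dual \<alpha>0 \<alpha>1) (Dual \<beta>0 \<beta>1) (dual_coords z)"
  using assms
  by (simp add: phase_space_def dual_coords_def phi_dual_def qrt_dual_def Let_def vector_4_nth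
      inverse_dual_number_def times_dual_number_def plus_dual_number_def
      field_simps power2_eq_square)

end

theory Submission
  imports Defs "HOL-Complex_Analysis.Cauchy_Integral_Formula"
begin

text \<open>
  The Jacobi identity applies the bracket to a bracket, so partial derivatives of a holomorphic
  function must themselves be holomorphic and must commute. Since holomorphy is assumed only as
  complex differentiability, this is extracted from Cauchy's formula on a circle in a coordinate
  line: it expresses \<open>\<partial>\<^sub>i F\<close> as a parameter integral of \<open>F\<close>, which first shows that \<open>\<partial>\<^sub>i F\<close> is
  continuous and then allows differentiation under the integral sign; the result is the Cauchy
  integral of \<open>\<partial>\<^sub>j F\<close>, which is \<open>\<partial>\<^sub>i (\<partial>\<^sub>j F)\<close>.

  Over the dual numbers, \<open>W\<^sub>1 W\<^sub>2 W\<^sub>3 = \<alpha> W\<^sub>2 + \<beta>\<close> along an orbit, and therefore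
  \<open>J = W\<^sub>1 + W\<^sub>2 + W\<^sub>3 + \<alpha> W\<^sub>2\<^sup>-\<^sup>1\<close>, which is symmetric in \<open>W\<^sub>1\<close> and \<open>W\<^sub>3\<close>: hence \<open>J\<close> is invariant. The
  differentials of \<open>J\<^sup>(\<^sup>0\<^sup>)\<close> and \<open>J\<^sup>(\<^sup>1\<^sup>)\<close> have the forms \<open>(a, b, 0, 0)\<close> and \<open>(c, d, a, b)\<close>, so the bracket of
  the two cancels and they are independent wherever \<open>a \<noteq> 0\<close>.
\<close>

subsection \<open>Partial derivatives of holomorphic functions\<close>

text \<open>The pairing is bilinear, without conjugation, so a derivative of this form is
  automatically complex linear; the real inner product of \<open>complex^4\<close> would not express
  this.\<close>

definition has_gradient ::
  "(complex^4 \<Rightarrow> complex) \<Rightarrow> complex^4 \<Rightarrow> complex^4 \<Rightarrow> bool" where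
  "has_gradient F g z \<longleftrightarrow> (F has_derivative (\<lambda>h. \<Sum>i\<in>UNIV. g $ i * h $ i)) (at z)"

lemma bounded_linear_smult_axis:
  "bounded_linear (\<lambda>t :: complex. t *s (axis i 1 :: complex^4))"
  unfolding linear_conv_bounded_linear[symmetric]
  by (rule linearI) (simp_all add: vec_eq_iff algebra_simps)

lemma has_gradient_imp_partial:
  assumes "has_gradient F g z"
  shows "((\<lambda>t. F (z + t *s axis i 1)) has_field_derivative g $ i) (at 0)"
    and "partial i F z = g $ i"
proof -
  have line: "((\<lambda>t. z + t *s axis i 1) has_derivative (\<lambda>t. t *s axis i 1)) (at (0 :: complex))"
    using has_derivative_add[OF has_derivative_const
        bounded_linear_imp_has_derivative[OF bounded_linear_smult_axis]] by simp
  have "(F has_derivative (\<lambda>h. \<Sum>j\<in>UNIV. g $ j * h $ j)) (at (z + 0 *s axis i 1))"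
    using assms by (simp add: has_gradient_def)
  from has_derivative_compose[OF line this]
  have "((\<lambda>t. F (z + t *s axis i 1)) has_derivative
          (\<lambda>t. \<Sum>j\<in>UNIV. g $ j * (t *s axis i 1) $ j)) (at 0)" .
  moreover have "(\<Sum>j\<in>UNIV. g $ j * (t *s axis i 1) $ j) = g $ i * t" for t
    by (simp add: axis_def if_distrib cong: if_cong)
  ultimately show *: "((\<lambda>t. F (z + t *s axis i 1)) has_field_derivative g $ i) (at 0)"
    by (simp add: has_field_derivative_def)
  show "partial i F z = g $ i"
    unfolding partial_def by (rule DERIV_imp_deriv[OF *])
qed

lemma complex_linear_expansion:
  fixes D :: "complex^4 \<Rightarrow> complex"
  assumes "linear D" and "\<And>c h. D (c *s h) = c * D h"
  shows "D h = (\<Sum>i\<in>UNIV. D (axis i 1) * h $ i)"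
proof -
  have "D h = D (\<Sum>i\<in>UNIV. h $ i *s axis i 1)"
    by (simp add: basis_expansion)
  also have "\<dots> = (\<Sum>i\<in>UNIV. D (axis i 1) * h $ i)"
    unfolding linear_sum[OF assms(1)] assms(2) by (simp add: mult.commute)
  finally show ?thesis .
qed

lemma holomorphic_fun_onI:
  assumes "\<And>z. z \<in> U \<Longrightarrow> \<exists>g. has_gradient F g z"
  shows "holomorphic_fun_on F U"
  unfolding holomorphic_fun_on_def
proof
  fix z assume "z \<in> U"
  then obtain g where "has_gradient F g z" using assms by blast
  then show "\<exists>D. (F has_derivative D) (at z) \<and> (\<forall>c h. D (c *s h) = c * D h)"
    unfolding has_gradient_def
    by (intro exI conjI allI) (auto simp: sum_distrib_left algebra_simps)
qed

text \<open>A complex linear derivative is determined by its values on the axis vectors, and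
  restriction to coordinate lines identifies these values with the partial derivatives.\<close>

lemma holomorphic_fun_on_gradient:
  assumes "holomorphic_fun_on F U" "z \<in> U"
  shows "has_gradient F (\<chi> i. partial i F z) z"
proof -
  obtain D where D: "(F has_derivative D) (at z)" "\<And>c h. D (c *s h) = c * D h"
    using assms unfolding holomorphic_fun_on_def by blast
  have "D = (\<lambda>h. \<Sum>i\<in>UNIV. (\<chi> i. D (axis i 1)) $ i * h $ i)"
    unfolding vec_lambda_beta
    by (rule ext) (rule complex_linear_expansion[OF has_derivative_linear[OF D(1)] D(2)])
  from has_derivative_eq_rhs[OF D(1) this] have *: "has_gradient F (\<chi> i. D (axis i 1)) z"
    unfolding has_gradient_def .
  have "(\<chi> i. partial i F z) = (\<chi> i. D (axis i 1))"
    using has_gradient_imp_partial(2)[OF *] by (simp add: vec_eq_iff)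
  with * show ?thesis by simp
qed

lemma holomorphic_fun_on_continuous:
  assumes "holomorphic_fun_on F U"
  shows "continuous_on U F"
  using assms unfolding holomorphic_fun_on_def
  by (meson continuous_at_imp_continuous_on has_derivative_continuous)

text \<open>Reduction to one complex variable, where Cauchy's formula is available.\<close>

lemma holomorphic_fun_on_line:
  assumes "holomorphic_fun_on F U" and "\<And>t. t \<in> S \<Longrightarrow> z + t *s axis i 1 \<in> U"
  shows "(\<lambda>t. F (z + t *s axis i 1)) holomorphic_on S"
proof -
  have "((\<lambda>t. F (z + t *s axis i 1)) has_field_derivative partial i F (z + t *s axis i 1))
          (at t within S)" if "t \<in> S" for t
  proof -
    \<comment> \<open>With the base point moved to parameter \<open>t\<close>, the gradient gives a
      derivative at 0; \<open>DERIV_shift\<close> then carries it back to \<open>t\<close>.\<close>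
    have "((\<lambda>s. F ((z + t *s axis i 1) + s *s axis i 1)) has_field_derivative
            partial i F (z + t *s axis i 1)) (at 0)"
      using has_gradient_imp_partial(1)
        [OF holomorphic_fun_on_gradient[OF assms(1) assms(2)[OF that]], of i] by simp
    then have "((\<lambda>s. F (z + (s + t) *s axis i 1)) has_field_derivative
            partial i F (z + t *s axis i 1)) (at 0)"
      by (simp add: algebra_simps)
    then show ?thesis
      using DERIV_shift[of "\<lambda>s. F (z + s *s axis i 1)" "partial i F (z + t *s axis i 1)" 0 t]
      by (auto intro: has_field_derivative_at_within)
  qed
  then show ?thesis
    unfolding holomorphic_on_def field_differentiable_def by blast
qed

section \<open>Cauchy integrals over circles in coordinate lines\<close>

definition loop :: "real \<Rightarrow> real \<Rightarrow> complex" where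
  "loop r s = circlepath 0 r s"

lemma norm_loop: "r > 0 \<Longrightarrow> norm (loop r s) = r"
  by (simp add: loop_def circlepath norm_mult)

lemma loop_nonzero: "r > 0 \<Longrightarrow> loop r s \<noteq> 0"
  using norm_loop[of r s] by auto

lemma continuous_on_loop [continuous_intros]:
  "continuous_on S f \<Longrightarrow> continuous_on S (\<lambda>x. loop r (f x))"
  unfolding loop_def circlepath by (intro continuous_intros)

lemma norm_smult_axis: "norm (t *s axis i 1 :: complex^4) = norm t"
proof -
  have "(\<Sum>j\<in>UNIV. (norm ((t *s axis i 1 :: complex^4) $ j))\<^sup>2) =
          (\<Sum>j\<in>UNIV. if j = i then (norm t)\<^sup>2 else 0)"
    by (rule sum.cong) (auto simp: axis_def)
  then show ?thesis
    by (simp add: norm_vec_def L2_set_def)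
qed

text \<open>Cauchy's formula for the first derivative has kernel \<open>1 / t^2\<close>. On the
  circle \<open>dt = 2 * pi * \<i> * t ds\<close>, which cancels one power of \<open>t\<close> and
  the constant in front of the integral.\<close>

lemma partial_integral:
  assumes F: "holomorphic_fun_on F U" and r: "r > 0" and sub: "cball z r \<subseteq> U"
  shows "partial i F z =
           integral (cbox 0 1) (\<lambda>s. F (z + loop r s *s axis i 1) / loop r s)"
proof -
  have hol: "(\<lambda>t. F (z + t *s axis i 1)) holomorphic_on cball 0 r"
    by (rule holomorphic_fun_on_line[OF F]) (use sub in \<open>auto simp: dist_norm norm_smult_axis\<close>)
  have "((\<lambda>t. F (z + t *s axis i 1) / (t - 0) ^ Suc 1) has_contour_integral
          (2 * pi * \<i>) / fact 1 * (deriv ^^ 1) (\<lambda>t. F (z + t *s axis i 1)) 0) (circlepath 0 r)"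
    using r by (intro Cauchy_has_contour_integral_higher_derivative_circlepath
        holomorphic_on_imp_continuous_on hol holomorphic_on_subset[OF hol]) auto
  then have "((\<lambda>t. F (z + t *s axis i 1) / t\<^sup>2) has_contour_integral
          (2 * pi * \<i>) * partial i F z) (circlepath 0 r)"
    by (simp add: partial_def power2_eq_square)
  moreover have "vector_derivative (circlepath 0 r) (at s) = 2 * pi * \<i> * loop r s" for s
    unfolding vector_derivative_circlepath loop_def by (simp add: circlepath)
  ultimately have "((\<lambda>s. F (z + loop r s *s axis i 1) / (loop r s)\<^sup>2 *
                 (2 * pi * \<i> * loop r s)) has_integral (2 * pi * \<i>) * partial i F z) {0..1}"
    unfolding has_contour_integral loop_def[symmetric] by (simp only:)
  then have "((\<lambda>s. 2 * pi * \<i> * (F (z + loop r s *s axis i 1) / loop r s)) has_integral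
                 (2 * pi * \<i>) * partial i F z) {0..1}"
  proof (rule has_integral_eq[rotated])
    fix s
    show "F (z + loop r s *s axis i 1) / (loop r s)\<^sup>2 * (2 * pi * \<i> * loop r s) =
        2 * pi * \<i> * (F (z + loop r s *s axis i 1) / loop r s)"
      by (simp add: power2_eq_square loop_nonzero r)
  qed
  from has_integral_mult_right[OF this, of "1 / (2 * pi * \<i>)"]
  have "((\<lambda>s. F (z + loop r s *s axis i 1) / loop r s) has_integral partial i F z) {0..1}"
    by simp
  then show ?thesis by (simp add: integral_unique cbox_interval)
qed

lemmas continuous_on_smult_axis [continuous_intros] =
  bounded_linear.continuous_on[OF bounded_linear_smult_axis]

text \<open>One radius \<open>r\<close> then serves for all centres in \<open>ball z r\<close>, with
  every circle inside \<open>ball z (2 * r)\<close>; hence the pairing of \<open>r\<close> with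
  \<open>2 * r\<close> in what follows.\<close>

lemma add_smult_axis_in_ball:
  assumes "x \<in> ball z r" and "norm t \<le> r"
  shows "x + t *s axis i 1 \<in> ball (z :: complex^4) (2 * r)"
proof -
  have "dist z (x + t *s axis i 1) \<le> dist z x + norm t"
    using dist_triangle[of z "x + t *s axis i 1" x] by (simp add: dist_norm norm_smult_axis)
  then show ?thesis using assms by simp
qed

lemma continuous_on_loop_shift:
  fixes z :: "complex^4"
  assumes "continuous_on (ball z (2 * r)) f" and "r > 0"
  shows "continuous_on (ball z r \<times> S) (\<lambda>(x, s). f (x + loop r s *s axis i 1))"
  unfolding case_prod_unfold
proof (rule continuous_on_compose2[OF assms(1)])
  show "continuous_on (ball z r \<times> S) (\<lambda>p. fst p + loop r (snd p) *s axis i 1)"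
    by (intro continuous_intros)
  show "(\<lambda>p. fst p + loop r (snd p) *s axis i 1) ` (ball z r \<times> S) \<subseteq> ball z (2 * r)"
    using add_smult_axis_in_ball assms(2) by (fastforce simp: norm_loop simp del: mem_ball)
qed

lemma partial_integral_ball:
  assumes F: "holomorphic_fun_on F (ball z (2 * r))" and r: "r > 0" and x: "x \<in> ball z r"
  shows "partial i F x =
           integral (cbox 0 1) (\<lambda>s. F (x + loop r s *s axis i 1) / loop r s)"
proof (rule partial_integral[OF F r])
  show "cball x r \<subseteq> ball z (2 * r)"
  proof
    fix y assume "y \<in> cball x r"
    then show "y \<in> ball z (2 * r)"
      using x dist_triangle[of z y x] by simp
  qed
qed

text \<open>The Cauchy integrand is jointly continuous in the centre and the parameter because
  \<open>F\<close> is continuous, and a parameter integral over a compact interval inherits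
  this.\<close>

lemma continuous_on_partial_ball:
  assumes F: "holomorphic_fun_on F (ball z (2 * r))" and r: "r > 0"
  shows "continuous_on (ball z r) (partial i F)"
proof -
  have "continuous_on (ball z r \<times> cbox 0 1) (\<lambda>(x, s). F (x + loop r s *s axis i 1) / loop r s)"
    using continuous_on_loop_shift[OF holomorphic_fun_on_continuous[OF F] r, of "cbox 0 1" i]
    unfolding case_prod_unfold
    by (intro continuous_intros) (use loop_nonzero[OF r] in auto)
  then have "continuous_on (ball z r)
      (\<lambda>x. integral (cbox 0 1) (\<lambda>s. F (x + loop r s *s axis i 1) / loop r s))"
    by (rule integral_continuous_on_param)
  then show ?thesis
    by (rule continuous_on_eq) (rule partial_integral_ball[OF F r, symmetric])
qed

lemma holomorphic_fun_on_subset: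
  "holomorphic_fun_on F U \<Longrightarrow> V \<subseteq> U \<Longrightarrow> holomorphic_fun_on F V"
  unfolding holomorphic_fun_on_def by blast

lemma continuous_on_partial:
  assumes F: "holomorphic_fun_on F U" and U: "open U"
  shows "continuous_on U (partial i F)"
proof (rule continuous_at_imp_continuous_on, rule ballI)
  fix z assume "z \<in> U"
  then obtain e where e: "e > 0" "ball z e \<subseteq> U"
    using U open_contains_ball by blast
  have "continuous_on (ball z (e / 2)) (partial i F)"
    by (rule continuous_on_partial_ball) (use e F holomorphic_fun_on_subset in auto)
  then show "isCont (partial i F) z"
    using e by (simp add: continuous_on_eq_continuous_at)
qed

section \<open>Differentiation under the integral sign\<close>

lift_definition gradient_blinfun :: "complex^4 \<Rightarrow> (complex^4) \<Rightarrow>\<^sub>L complex" is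
  "\<lambda>g h. \<Sum>i\<in>UNIV. g $ i * h $ i"
  by (intro bounded_linear_sum bounded_linear_const_mult bounded_linear_vec_nth)

text \<open>Linearity in finite dimension gives continuity, so a continuous gradient yields the
  continuous family of bounded linear maps that \<open>leibniz_rule\<close> asks for.\<close>

lemma linear_gradient_blinfun: "linear gradient_blinfun"
proof (rule linearI; rule blinfun_eqI)
  fix g g' h :: "complex^4"
  show "gradient_blinfun (g + g') h = (gradient_blinfun g + gradient_blinfun g') h"
    by (simp add: gradient_blinfun.rep_eq blinfun.add_left distrib_right sum.distrib)
next
  fix c :: real and g h :: "complex^4"
  show "gradient_blinfun (c *\<^sub>R g) h = (c *\<^sub>R gradient_blinfun g) h"
    by (simp only: gradient_blinfun.rep_eq blinfun.scaleR_left vector_scaleR_component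
        mult_scaleR_left scaleR_sum_right)
qed

lemmas continuous_on_gradient_blinfun [continuous_intros] =
  bounded_linear.continuous_on[OF linear_gradient_blinfun[unfolded linear_conv_bounded_linear]]

lemma has_gradient_partial_ball:
  assumes F: "holomorphic_fun_on F (ball z (2 * r))" and r: "r > 0"
  shows "has_gradient (partial i F)
           (\<chi> j. integral (cbox 0 1) (\<lambda>s. partial j F (z + loop r s *s axis i 1) / loop r s)) z"
proof -
  define f where "f x s = F (x + loop r s *s axis i 1) / loop r s" for x s
  define g where "g x s = (\<chi> j. partial j F (x + loop r s *s axis i 1) / loop r s)" for x s
  have mem: "x + loop r s *s axis i 1 \<in> ball z (2 * r)" if "x \<in> ball z r" for x s
    using that by (rule add_smult_axis_in_ball) (simp add: norm_loop r)
  have cont_f: "continuous_on (ball z r \<times> cbox 0 1) (\<lambda>(x, s). f x s)"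
    using continuous_on_loop_shift[OF holomorphic_fun_on_continuous[OF F] r, of "cbox 0 1" i]
    unfolding case_prod_unfold f_def
    by (intro continuous_intros) (use loop_nonzero[OF r] in auto)
  \<comment> \<open>This is where continuity of the first partial derivatives is indispensable: it
    makes the derivative of the integrand jointly continuous.\<close>
  have cont_g: "continuous_on (ball z r \<times> cbox 0 1) (\<lambda>(x, s). g x s)"
    using continuous_on_loop_shift[OF continuous_on_partial[OF F open_ball] r, of "cbox 0 1" _ i]
    unfolding case_prod_unfold g_def
    by (intro continuous_intros continuous_on_vec_lambda) (use loop_nonzero[OF r] in auto)
  have "((\<lambda>x. integral (cbox 0 1) (f x)) has_derivative
          integral (cbox 0 1) (\<lambda>s. gradient_blinfun (g z s))) (at z within ball z r)"
  proof (rule leibniz_rule)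
    fix x s assume x: "x \<in> ball z r"
    have "(F has_derivative (\<lambda>h. \<Sum>j\<in>UNIV. partial j F (x + loop r s *s axis i 1) * h $ j))
            (at (x + loop r s *s axis i 1))"
      using holomorphic_fun_on_gradient[OF F mem[OF x]] by (simp add: has_gradient_def)
    moreover have "((\<lambda>x. x + loop r s *s axis i 1) has_derivative (\<lambda>h. h)) (at x)"
      by (auto intro!: derivative_eq_intros)
    ultimately have "((\<lambda>x. F (x + loop r s *s axis i 1)) has_derivative
            (\<lambda>h. \<Sum>j\<in>UNIV. partial j F (x + loop r s *s axis i 1) * h $ j)) (at x)"
      by (rule has_derivative_compose[rotated])
    then have "((\<lambda>x. F (x + loop r s *s axis i 1) * inverse (loop r s)) has_derivative
        (\<lambda>h. (\<Sum>j\<in>UNIV. partial j F (x + loop r s *s axis i 1) * h $ j) * inverse (loop r s)))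
        (at x)"
      by (rule has_derivative_mult_left)
    moreover have "(\<Sum>j\<in>UNIV. partial j F (x + loop r s *s axis i 1) * h $ j) * inverse (loop r s)
        = gradient_blinfun (g x s) h" for h
      unfolding gradient_blinfun.rep_eq sum_distrib_right
      by (rule sum.cong) (simp_all add: g_def divide_inverse)
    ultimately show "((\<lambda>x. f x s) has_derivative blinfun_apply (gradient_blinfun (g x s)))
            (at x within ball z r)"
      by (simp add: f_def divide_inverse has_derivative_at_withinI)
  next
    fix x assume x: "x \<in> ball z r"
    have "continuous_on (cbox 0 1) (\<lambda>s. case (x, s) of (x, s) \<Rightarrow> f x s)"
      by (rule continuous_on_compose2[OF cont_f]) (use x in \<open>auto intro!: continuous_intros\<close>)
    then show "f x integrable_on cbox 0 1"
      by (intro integrable_continuous) simp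
  next
    show "continuous_on (ball z r \<times> cbox 0 1) (\<lambda>(x, s). gradient_blinfun (g x s))"
      using cont_g unfolding case_prod_unfold by (intro continuous_intros)
  qed (use r in auto)
  then have "((\<lambda>x. integral (cbox 0 1) (f x)) has_derivative
          integral (cbox 0 1) (\<lambda>s. gradient_blinfun (g z s))) (at z)"
    using r at_within_open[of z "ball z r"] by simp
  \<comment> \<open>The operator-valued integral is evaluated at a vector and split into
    coordinates, which brings it to gradient form.\<close>
  moreover have "blinfun_apply (integral (cbox 0 1) (\<lambda>s. gradient_blinfun (g z s))) =
      (\<lambda>h. \<Sum>j\<in>UNIV. (\<chi> j. integral (cbox 0 1)
         (\<lambda>s. partial j F (z + loop r s *s axis i 1) / loop r s)) $ j * h $ j)"
  proof
    fix h :: "complex^4"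
    have cz: "continuous_on (cbox 0 1) (\<lambda>s. case (z, s) of (x, s) \<Rightarrow> g x s)"
      by (rule continuous_on_compose2[OF cont_g]) (use r in \<open>auto intro!: continuous_intros\<close>)
    then have "(\<lambda>s. gradient_blinfun (g z s)) integrable_on cbox 0 1"
      by (intro integrable_continuous continuous_intros) simp
    then have "blinfun_apply (integral (cbox 0 1) (\<lambda>s. gradient_blinfun (g z s))) h =
        integral (cbox 0 1) (\<lambda>s. \<Sum>j\<in>UNIV. g z s $ j * h $ j)"
      by (simp add: blinfun_apply_integral gradient_blinfun.rep_eq)
    also have "\<dots> = (\<Sum>j\<in>UNIV. integral (cbox 0 1) (\<lambda>s. g z s $ j * h $ j))"
      using cz by (intro integral_sum integrable_continuous continuous_intros) auto
    also have "\<dots> = (\<Sum>j\<in>UNIV. integral (cbox 0 1) (\<lambda>s. g z s $ j) * h $ j)"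
      by simp
    finally show "blinfun_apply (integral (cbox 0 1) (\<lambda>s. gradient_blinfun (g z s))) h =
      (\<Sum>j\<in>UNIV. (\<chi> j. integral (cbox 0 1)
         (\<lambda>s. partial j F (z + loop r s *s axis i 1) / loop r s)) $ j * h $ j)"
      by (simp add: g_def)
  qed
  ultimately have deriv: "has_gradient (\<lambda>x. integral (cbox 0 1) (f x))
      (\<chi> j. integral (cbox 0 1) (\<lambda>s. partial j F (z + loop r s *s axis i 1) / loop r s)) z"
    unfolding has_gradient_def by simp
  \<comment> \<open>The integral agrees with \<open>partial i F\<close> on a whole neighbourhood of
    \<open>z\<close>, so its derivative at \<open>z\<close> transfers.\<close>
  have eq: "integral (cbox 0 1) (f x) = partial i F x" if "x \<in> ball z r" for x
    unfolding f_def by (rule partial_integral_ball[OF F r that, symmetric])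
  show ?thesis
    using deriv unfolding has_gradient_def
    by (rule has_derivative_transform_within_open[where s = "ball z r"]) (use r eq in auto)
qed

lemma holomorphic_fun_on_partial:
  assumes "holomorphic_fun_on F U" and "open U"
  shows "holomorphic_fun_on (partial i F) U"
proof (rule holomorphic_fun_onI)
  fix z assume "z \<in> U"
  then obtain e where e: "e > 0" "ball z e \<subseteq> U"
    using assms(2) open_contains_ball by blast
  have "holomorphic_fun_on F (ball z (2 * (e / 2)))"
    using e assms(1) holomorphic_fun_on_subset by auto
  with e show "\<exists>g. has_gradient (partial i F) g z"
    by (blast intro: has_gradient_partial_ball half_gt_zero)
qed

text \<open>Both sides are the same Cauchy integral of \<open>partial j F\<close> over a circle in
  direction \<open>i\<close>: one by differentiating the formula for \<open>partial i F\<close>, the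
  other by applying the formula to the holomorphic function \<open>partial j F\<close>.\<close>

lemma partial_commute:
  assumes "holomorphic_fun_on F U" and "open U" and "z \<in> U"
  shows "partial j (partial i F) z = partial i (partial j F) z"
proof -
  obtain e where e: "e > 0" "ball z e \<subseteq> U"
    using assms(2,3) open_contains_ball by blast
  define r where "r = e / 2"
  have r: "r > 0" and F: "holomorphic_fun_on F (ball z (2 * r))"
    using e assms(1) holomorphic_fun_on_subset by (auto simp: r_def)
  have "partial j (partial i F) z =
      integral (cbox 0 1) (\<lambda>s. partial j F (z + loop r s *s axis i 1) / loop r s)"
    using has_gradient_imp_partial(2)[OF has_gradient_partial_ball[OF F r, of i]] by simp
  also have "\<dots> = partial i (partial j F) z"
    by (rule partial_integral[symmetric, OF holomorphic_fun_on_partial[OF F open_ball] r])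
       (use r in auto)
  finally show ?thesis .
qed

section \<open>Calculus of gradients\<close>

named_theorems gradient_intros

lemma has_gradient_const [gradient_intros]: "has_gradient (\<lambda>_. c) 0 z"
  by (simp add: has_gradient_def)

lemma sum_mult_axis: "(\<Sum>i\<in>UNIV. m i * axis j 1 $ i) = (m j :: complex)" for j :: 4
proof -
  have "(\<Sum>i\<in>UNIV. m i * axis j 1 $ i) = (\<Sum>i\<in>UNIV. if i = j then m i else 0)"
    by (rule sum.cong) (auto simp: axis_def)
  then show ?thesis by simp
qed

lemma has_gradient_coord [gradient_intros]: "has_gradient (\<lambda>x. x $ j) (axis j 1) z"
  unfolding has_gradient_def mult.commute[of "axis j 1 $ _"] sum_mult_axis
  by (rule bounded_linear_imp_has_derivative[OF bounded_linear_vec_nth])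

lemma has_gradient_add [gradient_intros]:
  "has_gradient F f z \<Longrightarrow> has_gradient G g z \<Longrightarrow> has_gradient (\<lambda>x. F x + G x) (f + g) z"
  unfolding has_gradient_def
  by (drule (1) has_derivative_add) (simp add: distrib_right sum.distrib)

lemma has_gradient_mult [gradient_intros]:
  assumes "has_gradient F f z" and "has_gradient G g z"
  shows "has_gradient (\<lambda>x. F x * G x) (F z *s g + G z *s f) z"
proof -
  have "(\<lambda>h. F z * (\<Sum>i\<in>UNIV. g $ i * h $ i) + (\<Sum>i\<in>UNIV. f $ i * h $ i) * G z) =
      (\<lambda>h. \<Sum>i\<in>UNIV. (F z *s g + G z *s f) $ i * h $ i)"
    by (rule ext) (simp add: sum_distrib_left sum_distrib_right sum.distrib[symmetric] algebra_simps)
  then show ?thesis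
    using has_derivative_mult[OF assms[unfolded has_gradient_def]]
    unfolding has_gradient_def by simp
qed

lemma has_gradient_minus [gradient_intros]:
  "has_gradient F f z \<Longrightarrow> has_gradient (\<lambda>x. - F x) (- f) z"
  unfolding has_gradient_def
  by (drule has_derivative_minus) (simp add: sum_negf)

lemma has_gradient_diff [gradient_intros]:
  "has_gradient F f z \<Longrightarrow> has_gradient G g z \<Longrightarrow> has_gradient (\<lambda>x. F x - G x) (f - g) z"
  using has_gradient_add[of F f z "\<lambda>x. - G x" "- g"] has_gradient_minus[of G g z] by simp

lemma has_gradient_inverse [gradient_intros]:
  assumes "has_gradient F f z" and "F z \<noteq> 0"
  shows "has_gradient (\<lambda>x. inverse (F x)) ((- inverse ((F z)\<^sup>2)) *s f) z"
proof -
  have "(\<lambda>h. - (inverse (F z) * (\<Sum>i\<in>UNIV. f $ i * h $ i) * inverse (F z))) =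
      (\<lambda>h. \<Sum>i\<in>UNIV. ((- inverse ((F z)\<^sup>2)) *s f) $ i * h $ i)"
    by (rule ext)
       (simp add: sum_distrib_left sum_distrib_right sum_negf power2_eq_square algebra_simps)
  then show ?thesis
    using Deriv.has_derivative_inverse[OF assms(2) assms(1)[unfolded has_gradient_def]]
    unfolding has_gradient_def by simp
qed

lemma has_gradient_divide [gradient_intros]:
  assumes "has_gradient F f z" and "has_gradient G g z" and "G z \<noteq> 0"
  shows "has_gradient (\<lambda>x. F x / G x)
           (F z *s ((- inverse ((G z)\<^sup>2)) *s g) + inverse (G z) *s f) z"
  unfolding divide_inverse by (intro has_gradient_mult has_gradient_inverse assms)

lemma has_gradient_compose:
  assumes F: "has_gradient F f (\<phi> z)" and \<phi>: "\<And>k. has_gradient (\<lambda>x. \<phi> x $ k) (A $ k) z"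
  shows "has_gradient (F \<circ> \<phi>) (\<Sum>k\<in>UNIV. f $ k *s A $ k) z"
proof -
  \<comment> \<open>The map is reassembled from its coordinates, so that its derivative follows from
    their gradients, the rows of the Jacobian matrix \<open>A\<close>.\<close>
  have "((\<lambda>x. \<Sum>k\<in>UNIV. \<phi> x $ k *s axis k 1) has_derivative
          (\<lambda>h. \<Sum>k\<in>UNIV. (\<Sum>i\<in>UNIV. A $ k $ i * h $ i) *s axis k 1)) (at z)"
    by (intro has_derivative_sum bounded_linear.has_derivative[OF bounded_linear_smult_axis])
       (use \<phi> in \<open>simp add: has_gradient_def\<close>)
  then have "(\<phi> has_derivative
          (\<lambda>h. \<Sum>k\<in>UNIV. (\<Sum>i\<in>UNIV. A $ k $ i * h $ i) *s axis k 1)) (at z)"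
    by (simp only: basis_expansion)
  from has_derivative_compose[OF this F[unfolded has_gradient_def]]
  have "((\<lambda>x. F (\<phi> x)) has_derivative
      (\<lambda>h. \<Sum>k\<in>UNIV. f $ k * (\<Sum>i\<in>UNIV. A $ k $ i * h $ i))) (at z)"
    by (simp add: axis_def if_distrib cong: if_cong)
  moreover have "(\<Sum>k\<in>UNIV. f $ k * (\<Sum>i\<in>UNIV. A $ k $ i * h $ i)) =
      (\<Sum>i\<in>UNIV. (\<Sum>k\<in>UNIV. f $ k *s A $ k) $ i * h $ i)" for h
    unfolding sum_distrib_left sum_component vector_smult_component sum_distrib_right
    by (subst sum.swap) (simp only: mult.assoc)
  ultimately show ?thesis
    by (simp add: has_gradient_def comp_def)
qed

section \<open>Closure properties of holomorphic functions and locality of partial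
  derivatives\<close>

lemma holomorphic_fun_on_coord: "holomorphic_fun_on (\<lambda>x. x $ j) U"
  by (rule holomorphic_fun_onI, rule exI, rule has_gradient_coord)

lemma holomorphic_fun_on_const: "holomorphic_fun_on (\<lambda>_. c) U"
  by (rule holomorphic_fun_onI, rule exI, rule has_gradient_const)

lemma holomorphic_fun_on_add:
  "holomorphic_fun_on F U \<Longrightarrow> holomorphic_fun_on G U \<Longrightarrow> holomorphic_fun_on (\<lambda>x. F x + G x) U"
  by (rule holomorphic_fun_onI, rule exI, rule has_gradient_add; rule holomorphic_fun_on_gradient)

lemma holomorphic_fun_on_diff:
  "holomorphic_fun_on F U \<Longrightarrow> holomorphic_fun_on G U \<Longrightarrow> holomorphic_fun_on (\<lambda>x. F x - G x) U"
  by (rule holomorphic_fun_onI, rule exI, rule has_gradient_diff; rule holomorphic_fun_on_gradient)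

lemma holomorphic_fun_on_mult:
  "holomorphic_fun_on F U \<Longrightarrow> holomorphic_fun_on G U \<Longrightarrow> holomorphic_fun_on (\<lambda>x. F x * G x) U"
  by (rule holomorphic_fun_onI, rule exI, rule has_gradient_mult; rule holomorphic_fun_on_gradient)

lemmas holomorphic_fun_on_intros =
  holomorphic_fun_on_coord holomorphic_fun_on_const holomorphic_fun_on_add
  holomorphic_fun_on_diff holomorphic_fun_on_mult holomorphic_fun_on_partial

lemma partial_cong_open:
  assumes "holomorphic_fun_on F U" and "open U" and "z \<in> U" and "\<And>x. x \<in> U \<Longrightarrow> F x = G x"
  shows "partial i F z = partial i G z"
proof -
  have "has_gradient F (\<chi> i. partial i F z) z"
    using assms(1,3) by (rule holomorphic_fun_on_gradient)
  then have "has_gradient G (\<chi> i. partial i F z) z"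
    unfolding has_gradient_def
    by (rule has_derivative_transform_within_open[OF _ assms(2,3)]) (simp add: assms(4))
  then show ?thesis
    using has_gradient_imp_partial(2)[of G] by simp
qed

lemma partial_coord: "partial i (\<lambda>x. x $ j) z = axis j 1 $ i"
  by (rule has_gradient_imp_partial(2)[OF has_gradient_coord])

subsection \<open>The pencil of brackets\<close>

text \<open>This is the bracket of \<open>v\<^sub>1\<close> and \<open>v\<^sub>2\<close>, the only
  one among the coordinates that involves \<zeta>.\<close>

definition pencil_weight :: "complex \<Rightarrow> complex^4 \<Rightarrow> complex" where
  "pencil_weight \<zeta> z = z $ 1 * z $ 2 * \<zeta> - z $ 1 * z $ 4 - z $ 2 * z $ 3"

lemma pencil_matrix_nth:
  "pencil_matrix \<zeta> z $ 1 $ 1 = 0" "pencil_matrix \<zeta> z $ 1 $ 2 = 0"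
  "pencil_matrix \<zeta> z $ 1 $ 3 = 0" "pencil_matrix \<zeta> z $ 1 $ 4 = - (z $ 1 * z $ 2)"
  "pencil_matrix \<zeta> z $ 2 $ 1 = 0" "pencil_matrix \<zeta> z $ 2 $ 2 = 0"
  "pencil_matrix \<zeta> z $ 2 $ 3 = z $ 1 * z $ 2" "pencil_matrix \<zeta> z $ 2 $ 4 = 0"
  "pencil_matrix \<zeta> z $ 3 $ 1 = 0" "pencil_matrix \<zeta> z $ 3 $ 2 = - (z $ 1 * z $ 2)"
  "pencil_matrix \<zeta> z $ 3 $ 3 = 0" "pencil_matrix \<zeta> z $ 3 $ 4 = pencil_weight \<zeta> z"
  "pencil_matrix \<zeta> z $ 4 $ 1 = z $ 1 * z $ 2" "pencil_matrix \<zeta> z $ 4 $ 2 = 0"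
  "pencil_matrix \<zeta> z $ 4 $ 3 = - pencil_weight \<zeta> z" "pencil_matrix \<zeta> z $ 4 $ 4 = 0"
  unfolding pencil_matrix_def Let_def vector_4_nth pencil_weight_def by (rule refl)+

lemma pencil_bracket_expand:
  "pencil_bracket \<zeta> F G z =
     z $ 1 * z $ 2 * ((partial 4 F z * partial 1 G z - partial 1 F z * partial 4 G z) +
                      (partial 2 F z * partial 3 G z - partial 3 F z * partial 2 G z)) +
     pencil_weight \<zeta> z * (partial 3 F z * partial 4 G z - partial 4 F z * partial 3 G z)"
  unfolding pencil_bracket_def pencil_matrix_nth sum_4
  by (simp add: algebra_simps)

lemma holomorphic_fun_on_pencil_bracket:
  assumes "holomorphic_fun_on F U" and "holomorphic_fun_on G U" and "open U"
  shows "holomorphic_fun_on (pencil_bracket \<zeta> F G) U"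
proof -
  have eq: "pencil_bracket \<zeta> F G = (\<lambda>z.
     z $ 1 * z $ 2 * ((partial 4 F z * partial 1 G z - partial 1 F z * partial 4 G z) +
                      (partial 2 F z * partial 3 G z - partial 3 F z * partial 2 G z)) +
     (z $ 1 * z $ 2 * \<zeta> - z $ 1 * z $ 4 - z $ 2 * z $ 3) *
       (partial 3 F z * partial 4 G z - partial 4 F z * partial 3 G z))"
    by (simp add: fun_eq_iff pencil_bracket_expand pencil_weight_def)
  show ?thesis
    unfolding eq by (intro holomorphic_fun_on_intros assms)
qed

text \<open>Product rule for the expanded bracket: \<open>P k l\<close> are the 2 by 2 minors of the
  two gradients and \<open>D k l i\<close> their derivatives. The other factors are the derivatives
  of \<open>w\<^sub>1 w\<^sub>2\<close> and of \<open>pencil_weight\<close>.\<close>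

lemma partial_pencil_bracket:
  assumes F: "holomorphic_fun_on F U" and G: "holomorphic_fun_on G U" and U: "open U" "z \<in> U"
  defines "P \<equiv> \<lambda>k l x. partial k F x * partial l G x - partial l F x * partial k G x"
    and "D \<equiv> \<lambda>k l i. partial i (partial k F) z * partial l G z
               + partial k F z * partial i (partial l G) z
               - partial i (partial l F) z * partial k G z
               - partial l F z * partial i (partial k G) z"
  shows "partial i (pencil_bracket \<zeta> F G) z =
     (z $ 1 * axis 2 1 $ i + z $ 2 * axis 1 1 $ i) * (P 4 1 z + P 2 3 z)
     + z $ 1 * z $ 2 * (D 4 1 i + D 2 3 i)
     + ((z $ 1 * \<zeta> - z $ 3) * axis 2 1 $ i + (z $ 2 * \<zeta> - z $ 4) * axis 1 1 $ i
        - z $ 1 * axis 4 1 $ i - z $ 2 * axis 3 1 $ i) * P 3 4 z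
     + pencil_weight \<zeta> z * D 3 4 i"
proof -
  have g: "has_gradient (partial k H) (\<chi> i. partial i (partial k H) z) z"
    if "holomorphic_fun_on H U" for k H
    using holomorphic_fun_on_gradient[OF holomorphic_fun_on_partial[OF that U(1)] U(2)] .
  have P: "has_gradient (P k l) (\<chi> i. D k l i) z" for k l
  proof -
    have "has_gradient (P k l) ((partial k F z *s (\<chi> i. partial i (partial l G) z)
        + partial l G z *s (\<chi> i. partial i (partial k F) z))
        - (partial l F z *s (\<chi> i. partial i (partial k G) z)
        + partial k G z *s (\<chi> i. partial i (partial l F) z))) z"
      unfolding P_def by (intro gradient_intros g F G)
    moreover have "(partial k F z *s (\<chi> i. partial i (partial l G) z)
        + partial l G z *s (\<chi> i. partial i (partial k F) z))
        - (partial l F z *s (\<chi> i. partial i (partial k G) z)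
        + partial k G z *s (\<chi> i. partial i (partial l F) z)) = (\<chi> i. D k l i)"
      by (simp add: vec_eq_iff D_def algebra_simps)
    ultimately show ?thesis by simp
  qed
  have A: "pencil_bracket \<zeta> F G = (\<lambda>x. x $ 1 * x $ 2 * (P 4 1 x + P 2 3 x) +
     (x $ 1 * x $ 2 * \<zeta> - x $ 1 * x $ 4 - x $ 2 * x $ 3) * P 3 4 x)"
    by (simp add: fun_eq_iff pencil_bracket_expand pencil_weight_def P_def)
  \<comment> \<open>The nesting of the rules mirrors the expression in \<open>A\<close>.\<close>
  note B = has_gradient_imp_partial(2)[where i = i, OF has_gradient_add[OF
      has_gradient_mult[OF has_gradient_mult[OF has_gradient_coord[of 1] has_gradient_coord[of 2]]
        has_gradient_add[OF P[of 4 1] P[of 2 3]]]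
      has_gradient_mult[OF has_gradient_diff[OF has_gradient_diff[OF
        has_gradient_mult[OF has_gradient_mult[OF has_gradient_coord[of 1] has_gradient_coord[of 2]]
          has_gradient_const[of \<zeta>]]
        has_gradient_mult[OF has_gradient_coord[of 1] has_gradient_coord[of 4]]]
        has_gradient_mult[OF has_gradient_coord[of 2] has_gradient_coord[of 3]]] P[of 3 4]]]]
  show ?thesis
    unfolding A B pencil_weight_def vector_add_component vector_minus_component
      vector_smult_component zero_index vec_lambda_beta
    by (simp add: algebra_simps)
qed

text \<open>Second derivatives cancel by antisymmetry of the matrix and symmetry of mixed partials;
  what remains, bilinear in the matrix and its first derivatives, cancels by the Jacobi identity for
  the coordinate functions.\<close>

lemma pencil_bracket_jacobi:
  assumes hol: "holomorphic_fun_on F U" "holomorphic_fun_on G U" "holomorphic_fun_on H U"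
    and U: "open U" "z \<in> U"
  shows "pencil_bracket \<zeta> F (pencil_bracket \<zeta> G H) z
       + pencil_bracket \<zeta> G (pencil_bracket \<zeta> H F) z
       + pencil_bracket \<zeta> H (pencil_bracket \<zeta> F G) z = 0"
proof -
  note comm = partial_commute[OF _ U]
  \<comment> \<open>Mixed partials are normalised to have the smaller index outermost, so that equal
    ones become the same atom in the polynomial identity.\<close>
  have sym: "partial 2 (partial 1 K) z = partial 1 (partial 2 K) z"
     "partial 3 (partial 1 K) z = partial 1 (partial 3 K) z"
     "partial 4 (partial 1 K) z = partial 1 (partial 4 K) z"
     "partial 3 (partial 2 K) z = partial 2 (partial 3 K) z"
     "partial 4 (partial 2 K) z = partial 2 (partial 4 K) z"
     "partial 4 (partial 3 K) z = partial 3 (partial 4 K) z" if "holomorphic_fun_on K U" for K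
    using comm[OF that] by blast+
  have ax: "axis (1::4) (1::complex) $ 1 = 1" "axis (1::4) (1::complex) $ 2 = 0"
    "axis (1::4) (1::complex) $ 3 = 0" "axis (1::4) (1::complex) $ 4 = 0"
    "axis (2::4) (1::complex) $ 1 = 0" "axis (2::4) (1::complex) $ 2 = 1"
    "axis (2::4) (1::complex) $ 3 = 0" "axis (2::4) (1::complex) $ 4 = 0"
    "axis (3::4) (1::complex) $ 1 = 0" "axis (3::4) (1::complex) $ 2 = 0"
    "axis (3::4) (1::complex) $ 3 = 1" "axis (3::4) (1::complex) $ 4 = 0"
    "axis (4::4) (1::complex) $ 1 = 0" "axis (4::4) (1::complex) $ 2 = 0"
    "axis (4::4) (1::complex) $ 3 = 0" "axis (4::4) (1::complex) $ 4 = 1"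
    by (simp_all add: axis_def)
  show ?thesis
    \<comment> \<open>Only the outer brackets are expanded; the derivatives of the inner ones are
      left for \<open>partial_pencil_bracket\<close>.\<close>
    unfolding pencil_bracket_expand[of \<zeta> _ "pencil_bracket \<zeta> _ _"]
      partial_pencil_bracket[OF hol(2,3) U] partial_pencil_bracket[OF hol(3,1) U]
      partial_pencil_bracket[OF hol(1,2) U]
      sym[OF hol(1)] sym[OF hol(2)] sym[OF hol(3)] ax
    by algebra
qed

lemma open_phase_space: "open phase_space"
  unfolding phase_space_def by (intro open_Collect_neq continuous_intros)

lemma poisson_bracket_on_pencil: "poisson_bracket_on phase_space (pencil_bracket \<zeta>)"
  unfolding poisson_bracket_on_def
proof (intro conjI open_phase_space allI impI)
  fix U F G H
  assume "open U \<and> U \<subseteq> phase_space \<and> holomorphic_fun_on F U \<and> holomorphic_fun_on G U \<and>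
      holomorphic_fun_on H U"
  then have U: "open U" and F: "holomorphic_fun_on F U" and G: "holomorphic_fun_on G U"
    and H: "holomorphic_fun_on H U"
    by auto
  note grad = has_gradient_imp_partial(2)
  note gF = holomorphic_fun_on_gradient[OF F] and gG = holomorphic_fun_on_gradient[OF G]
  show "holomorphic_fun_on (pencil_bracket \<zeta> F G) U"
    by (rule holomorphic_fun_on_pencil_bracket[OF F G U])
  show "\<forall>z\<in>U. pencil_bracket \<zeta> F H z = pencil_bracket \<zeta> G H z" if "\<forall>z\<in>U. F z = G z"
  proof
    fix z assume z: "z \<in> U"
    have "partial i F z = partial i G z" for i
      by (rule partial_cong_open[OF F U z]) (use that in blast)
    then show "pencil_bracket \<zeta> F H z = pencil_bracket \<zeta> G H z"
      by (simp add: pencil_bracket_def)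
  qed
  show "\<forall>z\<in>U. pencil_bracket \<zeta> F G z = - pencil_bracket \<zeta> G F z"
    by (simp add: pencil_bracket_expand algebra_simps)
  show "\<forall>z\<in>U. pencil_bracket \<zeta> (\<lambda>x. c * F x + G x) H z =
      c * pencil_bracket \<zeta> F H z + pencil_bracket \<zeta> G H z" for c
  proof
    fix z assume z: "z \<in> U"
    have "partial i (\<lambda>x. c * F x + G x) z = c * partial i F z + partial i G z" for i
      using grad[OF has_gradient_add[OF has_gradient_mult[OF has_gradient_const gF[OF z]] gG[OF z]]]
      by simp
    then show "pencil_bracket \<zeta> (\<lambda>x. c * F x + G x) H z =
        c * pencil_bracket \<zeta> F H z + pencil_bracket \<zeta> G H z"
      by (simp add: pencil_bracket_expand algebra_simps)
  qed
  show "\<forall>z\<in>U. pencil_bracket \<zeta> (\<lambda>x. F x * G x) H z =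
      F z * pencil_bracket \<zeta> G H z + G z * pencil_bracket \<zeta> F H z"
  proof
    fix z assume z: "z \<in> U"
    have "partial i (\<lambda>x. F x * G x) z = F z * partial i G z + G z * partial i F z" for i
      using grad[OF has_gradient_mult[OF gF[OF z] gG[OF z]]] by simp
    then show "pencil_bracket \<zeta> (\<lambda>x. F x * G x) H z =
        F z * pencil_bracket \<zeta> G H z + G z * pencil_bracket \<zeta> F H z"
      by (simp add: pencil_bracket_expand algebra_simps)
  qed
  show "\<forall>z\<in>U. pencil_bracket \<zeta> F (pencil_bracket \<zeta> G H) z
       + pencil_bracket \<zeta> G (pencil_bracket \<zeta> H F) z
       + pencil_bracket \<zeta> H (pencil_bracket \<zeta> F G) z = 0"
    using pencil_bracket_jacobi[OF F G H U] by blast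
qed

lemma nondegenerate_bracket_on_pencil:
  "nondegenerate_bracket_on phase_space (pencil_bracket \<zeta>)"
  unfolding nondegenerate_bracket_on_def
proof
  fix z assume "z \<in> phase_space"
  then have p: "z $ 1 * z $ 2 \<noteq> 0"
    by (simp add: phase_space_def)
  have entry: "pencil_bracket \<zeta> (\<lambda>x. x $ i) (\<lambda>x. x $ j) z = pencil_matrix \<zeta> z $ i $ j" for i j
    unfolding pencil_bracket_def partial_coord sum_mult_axis ..
  \<comment> \<open>As \<open>w\<^sub>1 w\<^sub>2\<close> is nonzero, rows 1 and 2 kill
    \<open>x $ 4\<close> and \<open>x $ 3\<close>; rows 3 and 4 then kill \<open>x $ 2\<close> and
    \<open>x $ 1\<close>, whatever the weight.\<close>
  have "pencil_matrix \<zeta> z *v x = 0 \<Longrightarrow> x = 0" for x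
    using p by (auto simp: vec_eq_iff forall_4 matrix_vector_mult_def sum_4 pencil_matrix_nth)
  then have "invertible (pencil_matrix \<zeta> z)"
    by (simp add: invertible_left_inverse matrix_left_invertible_ker)
  then show "invertible (\<chi> i j. pencil_bracket \<zeta> (\<lambda>x. x $ i) (\<lambda>x. x $ j) z)"
    by (simp add: entry)
qed

section \<open>Invariance of the pencil under the map\<close>

lemma phase_spaceD: "z \<in> phase_space \<Longrightarrow> z $ 1 \<noteq> 0" "z \<in> phase_space \<Longrightarrow> z $ 2 \<noteq> 0"
  by (auto simp: phase_space_def)

text \<open>The chain rule expresses the partials of a composite at \<open>z\<close> through
  partials at the image point, which leaves a polynomial identity in these and the Jacobian
  entries.\<close>

lemma preserves_bracket_on_pencil:
  "preserves_bracket_on phase_space (phi_dual \<alpha>0 \<alpha>1 \<beta>0 \<beta>1) (pencil_bracket \<zeta>)"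
  unfolding preserves_bracket_on_def
proof (intro allI impI ballI)
  fix U F G z
  let ?\<phi> = "phi_dual \<alpha>0 \<alpha>1 \<beta>0 \<beta>1"
  assume *: "open U \<and> U \<subseteq> phase_space \<and> holomorphic_fun_on F U \<and> holomorphic_fun_on G U"
    and z: "z \<in> phase_space" and \<phi>z: "?\<phi> z \<in> U"
  note nz = phase_spaceD[OF z]
  define w3 where "w3 x = inverse (x $ 1) * inverse (x $ 2) * (\<alpha>0 * x $ 2 + \<beta>0)" for x :: "complex^4"
  define v3 where "v3 x = - inverse (x $ 2) * w3 x * x $ 4 - inverse (x $ 1) * w3 x * x $ 3
      + inverse (x $ 1) * inverse (x $ 2) * (\<alpha>0 * x $ 4 + \<alpha>1 * x $ 2 + \<beta>1)" for x :: "complex^4"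
  have \<phi>: "?\<phi> x $ 1 = x $ 2" "?\<phi> x $ 2 = w3 x" "?\<phi> x $ 3 = x $ 4" "?\<phi> x $ 4 = v3 x" for x
    by (simp_all add: phi_dual_def Let_def vector_4_nth w3_def v3_def)
  \<comment> \<open>\<open>a\<close> and \<open>b\<close> are the partials of \<open>w3\<close> in
    \<open>w\<^sub>1\<close> and \<open>w\<^sub>2\<close>, and \<open>c\<close> is that of
    \<open>v3\<close> in \<open>w\<^sub>1\<close>. Since \<open>v3\<close> is
    \<open>a v\<^sub>1 + b v\<^sub>2\<close> plus a term free of \<open>v\<^sub>1\<close> and
    \<open>v\<^sub>2\<close>, the gradient of \<open>v3\<close> ends in \<open>a, b\<close>.\<close>
  define a where "a = - w3 z / z $ 1"
  define b where "b = \<alpha>0 / (z $ 1 * z $ 2) - w3 z / z $ 2"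
  define c where "c = - v3 z / z $ 1 - a * z $ 3 / z $ 1"
  have grad_w3: "has_gradient w3 (vector [a, b, 0, 0]) z"
  proof -
    \<comment> \<open>The existential lets the gradient rules synthesise \<open>g\<close>, which is
      compared with the expected vector only afterwards.\<close>
    have "\<exists>g. has_gradient w3 g z \<and> g = vector [a, b, 0, 0]"
      unfolding w3_def[abs_def]
      by (rule exI, rule conjI, (rule gradient_intros nz)+)
        (use nz in \<open>auto simp: vec_eq_iff forall_4 vector_4_nth a_def b_def w3_def axis_def
           field_simps power2_eq_square\<close>)
    then show ?thesis by simp
  qed
  have "\<exists>d. has_gradient v3 (vector [c, d, a, b]) z"
  proof -
    have "\<exists>g. has_gradient v3 g z \<and> g $ 1 = c \<and> g $ 3 = a \<and> g $ 4 = b"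
      unfolding v3_def[abs_def]
      by (rule exI, rule conjI, (rule gradient_intros grad_w3 nz)+)
        (use nz in \<open>auto simp: vector_4_nth a_def b_def c_def v3_def axis_def
           field_simps power2_eq_square\<close>)
    then obtain g where g: "has_gradient v3 g z" "g $ 1 = c" "g $ 3 = a" "g $ 4 = b"
      by blast
    then have "g = vector [c, g $ 2, a, b]"
      by (simp add: vec_eq_iff forall_4 vector_4_nth)
    with g(1) show ?thesis by metis
  qed
  \<comment> \<open>The value of \<open>d\<close> is irrelevant: it enters the brackets of the new coordinates only through
    \<open>{w\<^sub>2, w\<^sub>1}\<close> and \<open>{w\<^sub>2, v\<^sub>2}\<close>, which vanish.\<close>
  then obtain d where grad_v3: "has_gradient v3 (vector [c, d, a, b]) z"
    by blast
  define A :: "complex^4^4" where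
    "A = vector [axis 2 1, vector [a, b, 0, 0], axis 4 1, vector [c, d, a, b]]"
  have "\<forall>k. has_gradient (\<lambda>x. ?\<phi> x $ k) (A $ k) z"
    unfolding forall_4 \<phi> A_def vector_4_nth
    using grad_w3 grad_v3 has_gradient_coord by blast
  then have A: "has_gradient (\<lambda>x. ?\<phi> x $ k) (A $ k) z" for k
    by blast
  have comp: "partial 1 (H \<circ> ?\<phi>) z = a * partial 2 H (?\<phi> z) + c * partial 4 H (?\<phi> z)"
      "partial 2 (H \<circ> ?\<phi>) z =
         partial 1 H (?\<phi> z) + b * partial 2 H (?\<phi> z) + d * partial 4 H (?\<phi> z)"
      "partial 3 (H \<circ> ?\<phi>) z = a * partial 4 H (?\<phi> z)"
      "partial 4 (H \<circ> ?\<phi>) z = partial 3 H (?\<phi> z) + b * partial 4 H (?\<phi> z)"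
    if "holomorphic_fun_on H U" for H
    unfolding has_gradient_imp_partial(2)
      [OF has_gradient_compose[OF holomorphic_fun_on_gradient[OF that \<phi>z] A]]
    by (simp_all add: sum_4 A_def vector_4_nth axis_def mult.commute)
  \<comment> \<open>Solving for \<open>w3\<close> and \<open>v3\<close> removes all divisions from
    the final identity.\<close>
  have w3: "w3 z = - z $ 1 * a" and v3: "v3 z = - z $ 1 * c - a * z $ 3"
    using nz by (simp_all add: a_def c_def field_simps)
  show "pencil_bracket \<zeta> (F \<circ> ?\<phi>) (G \<circ> ?\<phi>) z = pencil_bracket \<zeta> F G (?\<phi> z)"
    using * unfolding pencil_bracket_expand pencil_weight_def
    by (simp add: comp) (simp add: \<phi> w3 v3 algebra_simps)
qed

subsection \<open>The invariants\<close>

lemma qrt_dual_integral_invariant: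
  assumes "even_part W1 \<noteq> 0" and "even_part W2 \<noteq> 0"
    and "even_part (snd (qrt_dual \<alpha> \<beta> (W1, W2))) \<noteq> 0"
  shows "case_prod (qrt_dual_integral \<alpha> \<beta>) (qrt_dual \<alpha> \<beta> (W1, W2)) = qrt_dual_integral \<alpha> \<beta> W1 W2"
proof -
  define V W3 where "V = \<alpha> + \<beta> * inverse W2" and "W3 = inverse W1 * V"
  have W1: "W1 * inverse W1 = 1"
    by (rule dual_number_right_inverse[OF assms(1)])
  have W3: "W3 * inverse W3 = 1"
    by (rule dual_number_right_inverse) (use assms(3) in \<open>simp add: qrt_dual_def W3_def V_def\<close>)
  \<comment> \<open>Since \<open>V = W1 * W3\<close>, the sum of the terms of the shifted integral
    containing \<open>inverse W3\<close> is \<open>inverse W3 * V = W1\<close>.\<close>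
  have "inverse W3 * V = (W1 * inverse W1) * V * inverse W3"
    by (simp add: W1 mult.commute)
  also have "\<dots> = W1 * (W3 * inverse W3)"
    by (simp add: W3_def mult_ac)
  finally have "inverse W3 * V = W1"
    by (simp add: W3)
  then have "qrt_dual_integral \<alpha> \<beta> W2 W3 = W1 + W2 + W3 + \<alpha> * inverse W2"
    by (simp add: qrt_dual_integral_def V_def algebra_simps)
  moreover have "qrt_dual_integral \<alpha> \<beta> W1 W2 = W1 + W2 + W3 + \<alpha> * inverse W2"
    by (simp add: qrt_dual_integral_def W3_def V_def algebra_simps)
  ultimately show ?thesis
    by (simp add: qrt_dual_def W3_def V_def)
qed

text \<open>This carries the invariance proved in the ring of dual numbers over to \<open>J0\<close>
  and \<open>J1\<close>.\<close>

lemma qrt_dual_integral_components: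
  assumes "z \<in> phase_space"
  shows "case_prod (qrt_dual_integral (Dual \<alpha>0 \<alpha>1) (Dual \<beta>0 \<beta>1)) (dual_coords z)
           = Dual (J0 \<alpha>0 \<beta>0 z) (J1 \<alpha>0 \<alpha>1 \<beta>0 \<beta>1 z)"
  using phase_spaceD[OF assms]
  by (simp add: qrt_dual_integral_def dual_coords_def J0_def J1_def Let_def
      inverse_dual_number_def times_dual_number_def plus_dual_number_def
      field_simps power2_eq_square)

lemma J_invariant:
  assumes z: "z \<in> phase_space" and \<phi>z: "phi_dual \<alpha>0 \<alpha>1 \<beta>0 \<beta>1 z \<in> phase_space"
  shows "J0 \<alpha>0 \<beta>0 (phi_dual \<alpha>0 \<alpha>1 \<beta>0 \<beta>1 z) = J0 \<alpha>0 \<beta>0 z"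
    and "J1 \<alpha>0 \<alpha>1 \<beta>0 \<beta>1 (phi_dual \<alpha>0 \<alpha>1 \<beta>0 \<beta>1 z) = J1 \<alpha>0 \<alpha>1 \<beta>0 \<beta>1 z"
proof -
  let ?\<alpha> = "Dual \<alpha>0 \<alpha>1" and ?\<beta> = "Dual \<beta>0 \<beta>1" and ?\<phi> = "phi_dual \<alpha>0 \<alpha>1 \<beta>0 \<beta>1"
  obtain W1 W2 where W: "dual_coords z = (W1, W2)"
    by fastforce
  have \<phi>: "dual_coords (?\<phi> z) = qrt_dual ?\<alpha> ?\<beta> (W1, W2)"
    using phi_dual_components[OF z] W by simp
  have "even_part W1 \<noteq> 0" "even_part W2 \<noteq> 0"
    using W phase_spaceD[OF z] by (auto simp: dual_coords_def)
  moreover have "even_part (snd (qrt_dual ?\<alpha> ?\<beta> (W1, W2))) \<noteq> 0"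
    using phase_spaceD(2)[OF \<phi>z] unfolding \<phi>[symmetric] by (simp add: dual_coords_def)
  ultimately have "case_prod (qrt_dual_integral ?\<alpha> ?\<beta>) (dual_coords (?\<phi> z))
      = case_prod (qrt_dual_integral ?\<alpha> ?\<beta>) (dual_coords z)"
    unfolding \<phi> W by (simp add: qrt_dual_integral_invariant)
  then have "Dual (J0 \<alpha>0 \<beta>0 (?\<phi> z)) (J1 \<alpha>0 \<alpha>1 \<beta>0 \<beta>1 (?\<phi> z)) =
      Dual (J0 \<alpha>0 \<beta>0 z) (J1 \<alpha>0 \<alpha>1 \<beta>0 \<beta>1 z)"
    unfolding qrt_dual_integral_components[OF z] qrt_dual_integral_components[OF \<phi>z] .
  then show "J0 \<alpha>0 \<beta>0 (?\<phi> z) = J0 \<alpha>0 \<beta>0 z" and "J1 \<alpha>0 \<alpha>1 \<beta>0 \<beta>1 (?\<phi> z) = J1 \<alpha>0 \<alpha>1 \<beta>0 \<beta>1 z"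
    by simp_all
qed

section \<open>Involution, independence and integrability\<close>

lemma has_gradient_J:
  fixes \<alpha>0 \<alpha>1 \<beta>0 \<beta>1 :: complex
  assumes z: "z \<in> phase_space"
  defines "a \<equiv> 1 - \<alpha>0 / (z $ 1)\<^sup>2 - \<beta>0 / ((z $ 1)\<^sup>2 * z $ 2)"
    and "b \<equiv> 1 - \<alpha>0 / (z $ 2)\<^sup>2 - \<beta>0 / (z $ 1 * (z $ 2)\<^sup>2)"
  shows "has_gradient (J0 \<alpha>0 \<beta>0) (vector [a, b, 0, 0]) z"
    and "\<exists>c d. has_gradient (J1 \<alpha>0 \<alpha>1 \<beta>0 \<beta>1) (vector [c, d, a, b]) z"
proof -
  note nz = phase_spaceD[OF z]
  have "\<exists>g. has_gradient (J0 \<alpha>0 \<beta>0) g z \<and> g = vector [a, b, 0, 0]"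
    unfolding J0_def[abs_def] Let_def power2_eq_square
    by (rule exI, rule conjI, (rule gradient_intros nz no_zero_divisors)+)
      (use nz in \<open>auto simp: vec_eq_iff forall_4 vector_4_nth a_def b_def axis_def
         field_simps power2_eq_square\<close>)
  then show "has_gradient (J0 \<alpha>0 \<beta>0) (vector [a, b, 0, 0]) z" by simp
  have "\<exists>g. has_gradient (J1 \<alpha>0 \<alpha>1 \<beta>0 \<beta>1) g z \<and> g $ 3 = a \<and> g $ 4 = b"
    unfolding J1_def[abs_def] Let_def power2_eq_square
    by (rule exI, rule conjI, (rule gradient_intros nz no_zero_divisors)+)
      (use nz in \<open>auto simp: a_def b_def axis_def power2_eq_square\<close>)
  then obtain g where g: "has_gradient (J1 \<alpha>0 \<alpha>1 \<beta>0 \<beta>1) g z" "g $ 3 = a" "g $ 4 = b"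
    by blast
  then have "g = vector [g $ 1, g $ 2, a, b]"
    by (simp add: vec_eq_iff forall_4 vector_4_nth)
  with g(1) show "\<exists>c d. has_gradient (J1 \<alpha>0 \<alpha>1 \<beta>0 \<beta>1) (vector [c, d, a, b]) z"
    by metis
qed

text \<open>\<open>J0\<close> does not depend on \<open>v\<^sub>1, v\<^sub>2\<close>, so the weight
  term drops out and every \<zeta> is covered at once; what remains is
  \<open>w\<^sub>1 w\<^sub>2\<close> times \<open>- a b + b a\<close>, with \<open>a, b\<close> the
  partials of \<open>J0\<close> in \<open>w\<^sub>1, w\<^sub>2\<close>.\<close>

lemma in_involution_on_J:
  "in_involution_on phase_space (pencil_bracket \<zeta>) (J0 \<alpha>0 \<beta>0) (J1 \<alpha>0 \<alpha>1 \<beta>0 \<beta>1)"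
  unfolding in_involution_on_def
proof
  fix z assume z: "z \<in> phase_space"
  obtain c d where "has_gradient (J1 \<alpha>0 \<alpha>1 \<beta>0 \<beta>1)
      (vector [c, d, 1 - \<alpha>0 / (z $ 1)\<^sup>2 - \<beta>0 / ((z $ 1)\<^sup>2 * z $ 2),
                     1 - \<alpha>0 / (z $ 2)\<^sup>2 - \<beta>0 / (z $ 1 * (z $ 2)\<^sup>2)]) z"
    using has_gradient_J(2)[OF z] by blast
  note J1 = has_gradient_imp_partial(2)[OF this]
  note J0 = has_gradient_imp_partial(2)[OF has_gradient_J(1)[OF z]]
  show "pencil_bracket \<zeta> (J0 \<alpha>0 \<beta>0) (J1 \<alpha>0 \<alpha>1 \<beta>0 \<beta>1) z = 0"
    unfolding pencil_bracket_expand J0 J1 vector_4_nth by simp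
qed

text \<open>Independence holds wherever the first partial of \<open>J0\<close> is nonzero. For fixed
  \<open>w\<^sub>2\<close> it vanishes for at most two values of \<open>w\<^sub>1\<close>, so an
  arbitrarily small shift of \<open>w\<^sub>1\<close> suffices.\<close>

lemma functionally_independent_on_J:
  "functionally_independent_on phase_space (J0 \<alpha>0 \<beta>0) (J1 \<alpha>0 \<alpha>1 \<beta>0 \<beta>1)"
  unfolding functionally_independent_on_def
proof
  fix z assume z: "z \<in> phase_space"
  note nz = phase_spaceD[OF z]
  \<comment> \<open>Multiplied by \<open>w\<^sub>1^2\<close>, the first partial of \<open>J0\<close>
    becomes \<open>w\<^sub>1^2 - s^2\<close>. The shifts \<open>t\<close> excluded below are those
    that send \<open>w\<^sub>1\<close> to 0, \<open>s\<close> or \<open>- s\<close>.\<close>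
  define s where "s = csqrt (\<alpha>0 + \<beta>0 / z $ 2)"
  show "z \<in> closure {z \<in> phase_space. \<forall>a b.
      (\<forall>i. a * partial i (J0 \<alpha>0 \<beta>0) z + b * partial i (J1 \<alpha>0 \<alpha>1 \<beta>0 \<beta>1) z = 0) \<longrightarrow>
      a = 0 \<and> b = 0}" (is "z \<in> closure ?I")
    unfolding closure_approachable
  proof (intro allI impI)
    fix e :: real assume e: "e > 0"
    have "infinite (ball (0 :: complex) e)"
      using e by (intro uncountable_infinite uncountable_ball)
    then have "infinite (ball 0 e - {- z $ 1, s - z $ 1, - s - z $ 1})"
      by simp
    then have "ball 0 e - {- z $ 1, s - z $ 1, - s - z $ 1} \<noteq> {}"
      by (rule infinite_imp_nonempty)
    then obtain t where t: "t \<in> ball 0 e" "t \<noteq> - z $ 1" "t \<noteq> s - z $ 1" "t \<noteq> - s - z $ 1"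
      by blast
    define y where "y = z + t *s axis 1 1"
    have y: "y $ 1 = z $ 1 + t" "y $ 2 = z $ 2"
      by (simp_all add: y_def axis_def)
    have "y $ 1 \<noteq> 0"
      using t(2) y by (metis add.commute eq_neg_iff_add_eq_0)
    then have yM: "y \<in> phase_space"
      using nz y by (simp add: phase_space_def)
    have "(y $ 1)\<^sup>2 \<noteq> s\<^sup>2"
      using t(3,4) unfolding y power2_eq_iff by (auto simp: algebra_simps)
    moreover have "(1 - \<alpha>0 / (y $ 1)\<^sup>2 - \<beta>0 / ((y $ 1)\<^sup>2 * y $ 2)) * (y $ 1)\<^sup>2 = (y $ 1)\<^sup>2 - s\<^sup>2"
      (is "?a * _ = _")
      using \<open>y $ 1 \<noteq> 0\<close> nz(2) by (simp add: s_def y(2) left_diff_distrib)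
    ultimately have ne: "?a \<noteq> 0"
      by auto
    obtain c d where "has_gradient (J1 \<alpha>0 \<alpha>1 \<beta>0 \<beta>1)
        (vector [c, d, ?a, 1 - \<alpha>0 / (y $ 2)\<^sup>2 - \<beta>0 / (y $ 1 * (y $ 2)\<^sup>2)]) y"
      using has_gradient_J(2)[OF yM] by blast
    note J1 = has_gradient_imp_partial(2)[OF this]
    note J0 = has_gradient_imp_partial(2)[OF has_gradient_J(1)[OF yM]]
    \<comment> \<open>The third component forces the coefficient of \<open>J1\<close> to vanish, and
      then the first component forces that of \<open>J0\<close> to vanish.\<close>
    have "y \<in> ?I"
      using yM ne unfolding mem_Collect_eq forall_4 J0 J1 vector_4_nth by auto
    moreover have "dist y z < e"
      using t(1) by (simp add: y_def dist_norm norm_smult_axis)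
    ultimately show "\<exists>y\<in>?I. dist y z < e" by blast
  qed
qed

lemma liouville_integrable_with_pencil:
  "liouville_integrable_with phase_space (phi_dual \<alpha>0 \<alpha>1 \<beta>0 \<beta>1) (pencil_bracket \<zeta>)
     (J0 \<alpha>0 \<beta>0) (J1 \<alpha>0 \<alpha>1 \<beta>0 \<beta>1)"
proof -
  have J0: "holomorphic_fun_on (J0 \<alpha>0 \<beta>0) phase_space"
    by (rule holomorphic_fun_onI) (use has_gradient_J(1) in blast)
  have J1: "holomorphic_fun_on (J1 \<alpha>0 \<alpha>1 \<beta>0 \<beta>1) phase_space"
    by (rule holomorphic_fun_onI) (use has_gradient_J(2) in blast)
  show ?thesis
    unfolding liouville_integrable_with_def invariant_on_def
    by (intro conjI ballI impI J0 J1 poisson_bracket_on_pencil nondegenerate_bracket_on_pencil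
        preserves_bracket_on_pencil functionally_independent_on_J in_involution_on_J J_invariant;
        assumption)
qed

theorem theorem6p2:
  fixes \<alpha>0 \<alpha>1 \<beta>0 \<beta>1 :: complex
  shows "preserves_poisson_pencil_on phase_space (phi_dual \<alpha>0 \<alpha>1 \<beta>0 \<beta>1) pencil_bracket \<and>
    (\<forall>z\<in>phase_space.
       case_prod (qrt_dual_integral (Dual \<alpha>0 \<alpha>1) (Dual \<beta>0 \<beta>1)) (dual_coords z)
         = Dual (J0 \<alpha>0 \<beta>0 z) (J1 \<alpha>0 \<alpha>1 \<beta>0 \<beta>1 z)) \<and>
    (\<forall>\<zeta>. in_involution_on phase_space (pencil_bracket \<zeta>) (J0 \<alpha>0 \<beta>0) (J1 \<alpha>0 \<alpha>1 \<beta>0 \<beta>1)) \<and>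
    (\<forall>\<zeta>. liouville_integrable_with phase_space (phi_dual \<alpha>0 \<alpha>1 \<beta>0 \<beta>1) (pencil_bracket \<zeta>)
          (J0 \<alpha>0 \<beta>0) (J1 \<alpha>0 \<alpha>1 \<beta>0 \<beta>1)) \<and>
    liouville_integrable phase_space (phi_dual \<alpha>0 \<alpha>1 \<beta>0 \<beta>1)"
proof (intro conjI allI ballI)
  show "preserves_poisson_pencil_on phase_space (phi_dual \<alpha>0 \<alpha>1 \<beta>0 \<beta>1) pencil_bracket"
    unfolding preserves_poisson_pencil_on_def
    by (intro allI conjI poisson_bracket_on_pencil preserves_bracket_on_pencil)
  \<comment> \<open>Any member of the pencil is a witness for the bracket.\<close>
  show "liouville_integrable phase_space (phi_dual \<alpha>0 \<alpha>1 \<beta>0 \<beta>1)"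
    unfolding liouville_integrable_def using liouville_integrable_with_pencil by blast
qed (fact qrt_dual_integral_components in_involution_on_J liouville_integrable_with_pencil)+

end
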